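(* Let $n\ge 1$ be an integer and let $\Phi$ be the $n$-dimensional Matérn cluster process with parent intensity $\lambda_{\mathrm p}>0$, daughter intensity $\lambda_{\mathrm d}>0$ and cluster radius $r_{\mathrm d}>0$. Let $R_{\mathrm C}=\min_{\mathbf z\in\Phi}\|\mathbf z\|$ be the contact distance and $F_{R_{\mathrm C}}(r)=\mathbb P(R_{\mathrm C}\le r)$. Then for every $r>0$, \[ F_{R_{\mathrm C}}(r)=1-\exp\!\left(-v_n\, n\, \lambda_{\mathrm p}\int_0^{r+r_{\mathrm d}}\left(1-e^{-\lambda_{\mathrm d}A(r,r_{\mathrm d},x)}\right)x^{n-1}\,\mathrm dx\right) \] \[ =1-\exp\!\left(-v_n\lambda_{\mathrm p}\left((r+r_{\mathrm d})^n-|r-r_{\mathrm d}|^n e^{-\lambda_{\mathrm d}v_n\beta(r)^n}-n\int_{|r-r_{\mathrm d}|}^{r+r_{\mathrm d}}e^{-\lambda_{\mathrm d}A(r,r_{\mathrm d},x)}x^{n-1}\,\mathrm dx\right)\right). \]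
   Context: The $n$-dimensional Matérn cluster process (MCP): let $\Phi_{\mathrm p}=\{\mathbf x_i\}$ be a homogeneous Poisson point process in $\mathbb R^n$ of intensity $\lambda_{\mathrm p}$ (the parent process). To each parent $\mathbf x_i$ associate a daughter process $\Phi_{\mathrm d}^{(i)}$, a homogeneous Poisson point process of intensity $\lambda_{\mathrm d}$ restricted to the ball $\mathcal B(\mathrm o,r_{\mathrm d})$ of radius $r_{\mathrm d}$ centered at the origin; the daughter processes are independent of each other and of $\Phi_{\mathrm p}$. The MCP is $\Phi=\bigcup_i(\mathbf x_i+\Phi_{\mathrm d}^{(i)})$. Notation: $v_n$ is the volume of the unit ball in $\mathbb R^n$; $A(r,r_{\mathrm d},x)$ is the volume of the intersection of two $n$-dimensional balls of radii $r$ and $r_{\mathrm d}$ whose centers are at distance $x$; $\beta(r)=\min\{r,r_{\mathrm d}\}$. *)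

theory Defs
  imports "HOL-Probability.Probability"
begin

definition pp_space :: "('b::euclidean_space) set measure" where
  "pp_space = sigma UNIV
     {{S. finite (S \<inter> B) \<and> card (S \<inter> B) = k} | B k. B \<in> sets borel \<and> bounded B}"

definition poisson_pp :: "'a measure \<Rightarrow> ('a \<Rightarrow> ('b::euclidean_space) set) \<Rightarrow> real \<Rightarrow> 'b set \<Rightarrow> bool" where
  "poisson_pp M Psi lam W \<longleftrightarrow>
     prob_space M \<and>
     (\<forall>\<omega>\<in>space M. Psi \<omega> \<subseteq> W \<and> (\<forall>B. bounded B \<longrightarrow> finite (Psi \<omega> \<inter> B))) \<and>
     (\<forall>B k. B \<in> sets borel \<longrightarrow> bounded B \<longrightarrow>
        measure M {\<omega> \<in> space M. card (Psi \<omega> \<inter> B) = k}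
          = exp (- (lam * measure lborel (B \<inter> W))) * (lam * measure lborel (B \<inter> W)) ^ k / fact k) \<and>
     (\<forall>(I::nat set) B. finite I \<longrightarrow> (\<forall>i\<in>I. B i \<in> sets borel \<and> bounded (B i)) \<longrightarrow>
        disjoint_family_on B I \<longrightarrow>
        prob_space.indep_vars M (\<lambda>_. count_space UNIV) (\<lambda>i \<omega>. card (Psi \<omega> \<inter> B i)) I)"

text \<open>Matern cluster process. The parent PPP (intensity lam_p on the whole space) is given by
  an injective enumeration X of its points; D j is the daughter process attached to the
  j-th parent: PPP of intensity lam_d restricted to the ball B(0, r_d). The daughters are
  mutually independent and independent of the parent process. Phi is the union of the
  translated daughter processes.\<close>
definition matern_cluster ::
  "'a measure \<Rightarrow> real \<Rightarrow> real \<Rightarrow> real \<Rightarrow> (nat \<Rightarrow> 'a \<Rightarrow> 'b::euclidean_space)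
     \<Rightarrow> (nat \<Rightarrow> 'a \<Rightarrow> 'b set) \<Rightarrow> ('a \<Rightarrow> 'b set) \<Rightarrow> bool" where
  "matern_cluster M lam_p lam_d r_d X D Phi \<longleftrightarrow>
     prob_space M \<and>
     (\<forall>\<omega>\<in>space M. inj (\<lambda>i. X i \<omega>)) \<and>
     (\<forall>i. X i \<in> borel_measurable M) \<and>
     poisson_pp M (\<lambda>\<omega>. range (\<lambda>i. X i \<omega>)) lam_p UNIV \<and>
     (\<forall>j. poisson_pp M (D j) lam_d (ball 0 r_d)) \<and>
     prob_space.indep_vars M (\<lambda>_. pp_space) D UNIV \<and>
     prob_space.indep_set M
        (sets (vimage_algebra (space M) (\<lambda>\<omega> i. X i \<omega>) (Pi\<^sub>M UNIV (\<lambda>_. borel))))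
        (sets (vimage_algebra (space M) (\<lambda>\<omega> j. D j \<omega>) (Pi\<^sub>M UNIV (\<lambda>_. pp_space)))) \<and>
     (\<forall>\<omega>\<in>space M. Phi \<omega> = (\<Union>i. (\<lambda>y. X i \<omega> + y) ` D i \<omega>))"

definition contact_dist :: "('a \<Rightarrow> ('b::euclidean_space) set) \<Rightarrow> 'a \<Rightarrow> real" where
  "contact_dist Phi \<omega> = Inf (norm ` Phi \<omega>)"

definition unit_ball_volume :: "'b::euclidean_space itself \<Rightarrow> real" where
  "unit_ball_volume _ = measure lborel (ball (0::'b) 1)"

definition lens_vol :: "'b::euclidean_space itself \<Rightarrow> real \<Rightarrow> real \<Rightarrow> real \<Rightarrow> real" where
  "lens_vol _ r r_d x = measure lborel (ball (0::'b) r \<inter> ball (x *\<^sub>R (SOME b. b \<in> (Basis::'b set))) r_d)"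

end

theory Submission
  imports Defs
begin

text \<open>The ball of radius \<open>r\<close> about the origin misses \<open>Phi\<close> iff, for every \<open>i\<close>, the daughter set \<open>D i\<close> misses
  the ball of radius \<open>r\<close> about \<open>- X i\<close>. Conditionally on the parents these events are independent with
  probabilities \<open>q (norm (X i))\<close>, where \<open>q t = exp (- lam_d * lens_vol r r_d t)\<close>: the lens volume depends on the
  distance of the centres only, by rotation invariance of Lebesgue measure. Hence the void probability
  is the generating functional of the parent Poisson process at \<open>q \<circ> norm\<close>, that is
  \<open>exp (- lam_p * \<integral> (1 - q (norm x)) dx)\<close>, and polar coordinates give the first formula.
  Splitting the radial integral at \<open>\<bar>r - r_d\<bar>\<close>, below which one ball contains the other,
  gives the second one.\<close>

subsection \<open>Vacancy events\<close>

text \<open>A limit point would have infinitely many points of \<open>S\<close> in the unit ball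
  around it. Closedness is what lets vacancy be tested with a positive margin and lets the contact
  distance be attained.\<close>

lemma locally_finite_imp_closed:
  fixes S :: "'b::euclidean_space set"
  assumes "\<And>B. bounded B \<Longrightarrow> finite (S \<inter> B)"
  shows "closed S"
  unfolding closed_limpt islimpt_eq_infinite_ball
  using assms bounded_ball zero_less_one by blast

lemma space_pp_space [simp]: "space pp_space = UNIV"
  by (simp add: pp_space_def space_measure_of_conv)

lemma vacancy_in_sets_pp_space:
  assumes "B \<in> sets borel" "bounded B"
  shows "{S. S \<inter> B = {}} \<in> sets pp_space"
proof -
  \<comment> \<open>\<open>card\<close> is also 0 on infinite sets; the finiteness conjunct of the
    generators rules these out.\<close>
  have "{S. S \<inter> B = {}} = {S. finite (S \<inter> B) \<and> card (S \<inter> B) = 0}"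
    by auto
  then show ?thesis
    unfolding pp_space_def using assms
    by (auto intro!: sigma_sets.Basic simp: sets_measure_of_conv)
qed

text \<open>The points of a closed set stay at a positive distance from a disjoint closed ball, so vacancy of
  the ball is witnessed by vacancy of one of countably many slightly larger balls.\<close>
lemma vacancy_jointly_measurable:
  fixes r :: real
  assumes "r \<ge> 0"
  obtains V :: "('b::euclidean_space \<times> 'b set) set"
  where "V \<in> sets (borel \<Otimes>\<^sub>M pp_space)"
    and "\<And>c S. closed S \<Longrightarrow> (c, S) \<in> V \<longleftrightarrow> S \<inter> cball c r = {}"
proof -
  obtain Q :: "'b set" where Q: "countable Q" "\<And>U. open U \<Longrightarrow> U \<noteq> {} \<Longrightarrow> \<exists>q\<in>Q. q \<in> U"
    using countable_dense_setE by blast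
  define V where "V = (\<Union>q\<in>Q. \<Union>k. ball q (1 / real (Suc k)) \<times> {S. S \<inter> ball q (r + 1 / real (Suc k)) = {}})"
  have "V \<in> sets (borel \<Otimes>\<^sub>M pp_space)"
    unfolding V_def
    by (intro sets.countable_UN' sets.countable_UN Q pair_measureI) 
       (auto intro!: pair_measureI vacancy_in_sets_pp_space)
  moreover have "(c, S) \<in> V \<longleftrightarrow> S \<inter> cball c r = {}" if "closed S" for c S
  proof
    assume "(c, S) \<in> V"
    then obtain q k where q: "dist q c < 1 / real (Suc k)" "S \<inter> ball q (r + 1 / real (Suc k)) = {}"
      by (auto simp: V_def)
    have "cball c r \<subseteq> ball q (r + 1 / real (Suc k))"
    proof
      fix y assume "y \<in> cball c r"
      then show "y \<in> ball q (r + 1 / real (Suc k))"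
        using q(1) dist_triangle[of q y c] by auto
    qed
    with q(2) show "S \<inter> cball c r = {}" by blast
  next
    assume "S \<inter> cball c r = {}"
    then obtain d where d: "d > 0" "\<And>x y. x \<in> cball c r \<Longrightarrow> y \<in> S \<Longrightarrow> d \<le> dist x y"
      using separate_compact_closed[OF compact_cball \<open>closed S\<close>] by (metis Int_commute)
    have far: "r + d \<le> dist c y" if "y \<in> S" for y
    proof (rule ccontr)
      assume *: "\<not> ?thesis"
      have "y \<notin> cball c r"
        using \<open>S \<inter> cball c r = {}\<close> that by auto
      then have pos: "dist c y > r" by auto
      \<comment> \<open>The point where the segment from \<open>c\<close> to \<open>y\<close> leaves
        the ball: it lies at distance \<open>dist c y - r\<close> from \<open>y\<close>, which is
        less than \<open>d\<close> by assumption.\<close>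
      define x where "x = c + (r / dist c y) *\<^sub>R (y - c)"
      have "norm (y - c) = dist c y"
        by (simp add: dist_norm norm_minus_commute)
      have "dist c x = r"
        using pos that assms \<open>norm (y - c) = dist c y\<close> by (auto simp: x_def dist_norm)
      have "y - x = (1 - r / dist c y) *\<^sub>R (y - c)"
        by (simp add: x_def algebra_simps)
      moreover have "0 \<le> 1 - r / dist c y"
        using pos assms by (simp add: divide_le_eq)
      ultimately have "dist x y = (1 - r / dist c y) * dist c y"
        by (simp add: dist_norm norm_minus_commute[of x y] norm_minus_commute[of c y])
      moreover have "c \<noteq> y"
        using pos assms by auto
      ultimately have "dist x y = dist c y - r"
        by (simp add: left_diff_distrib)
      with \<open>dist c x = r\<close> show False
        using d(2)[of x y] that * by auto
    qed
    \<comment> \<open>Half of \<open>d\<close> pays for moving the centre from \<open>c\<close> to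
      \<open>q\<close>, the other half for enlarging the radius.\<close>
    obtain k where k: "1 / real (Suc k) < d / 2"
      using d(1) nat_approx_posE[of "d / 2"] by auto
    obtain q where q: "q \<in> Q" "dist c q < 1 / real (Suc k)"
      using Q(2)[of "ball c (1 / real (Suc k))"] by auto
    have "r + 1 / real (Suc k) \<le> dist q y" if "y \<in> S" for y
      using far[OF that] dist_triangle[of c y q] q k by linarith
    then have "S \<inter> ball q (r + 1 / real (Suc k)) = {}"
      by (force simp: not_less)
    moreover have "c \<in> ball q (1 / real (Suc k))"
      using q by (simp add: dist_commute)
    ultimately show "(c, S) \<in> V"
      unfolding V_def using q(1) by blast
  qed
  ultimately show thesis by (rule that)
qed

text \<open>Conditioning by Fubini: the joint law of the families \<open>X\<close> and
  \<open>D\<close> is a product, and once the values of \<open>X\<close> are frozen the events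
  concern independent \<open>D i\<close>. The factors on the right may still depend on each other
  through \<open>X\<close>, so the product stays under the expectation.\<close>

lemma (in prob_space) prob_all_indep_pairs:
  fixes X :: "'i \<Rightarrow> 'a \<Rightarrow> 'x" and D :: "'i \<Rightarrow> 'a \<Rightarrow> 'y"
  assumes X: "\<And>i. random_variable N (X i)"
    and D: "indep_vars (\<lambda>_. K) D UNIV"
    and XD: "indep_set
        (sets (vimage_algebra (space M) (\<lambda>\<omega> i. X i \<omega>) (Pi\<^sub>M UNIV (\<lambda>_. N))))
        (sets (vimage_algebra (space M) (\<lambda>\<omega> i. D i \<omega>) (Pi\<^sub>M UNIV (\<lambda>_. K))))"
    and V: "V \<in> sets (N \<Otimes>\<^sub>M K)"
    and I: "finite I"
  shows "prob {\<omega> \<in> space M. \<forall>i\<in>I. (X i \<omega>, D i \<omega>) \<in> V} =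
    expectation (\<lambda>\<omega>. \<Prod>i\<in>I. prob {\<omega>' \<in> space M. (X i \<omega>, D i \<omega>') \<in> V})"
proof (cases "I = {}")
  \<comment> \<open>Treated separately because an intersection over the empty \<open>I\<close> would
    be \<open>UNIV\<close> instead of \<open>space M\<close>.\<close>
  case True
  then show ?thesis by (simp add: prob_space)
next
  case False
  define PX where "PX = Pi\<^sub>M (UNIV :: 'i set) (\<lambda>_. N)"
  define PK where "PK = Pi\<^sub>M (UNIV :: 'i set) (\<lambda>_. K)"
  define Xv where "Xv = (\<lambda>\<omega> i. X i \<omega>)"
  define Dv where "Dv = (\<lambda>\<omega> i. D i \<omega>)"
  have Di: "random_variable K (D i)" for i
    using D by (auto simp: indep_vars_def)
  have Xv: "random_variable PX Xv"
    unfolding PX_def Xv_def by (rule measurable_PiM_single') (auto intro: X measurable_space[OF X])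
  have Dv: "random_variable PK Dv"
    unfolding PK_def Dv_def by (rule measurable_PiM_single') (auto intro: Di measurable_space[OF Di])
  interpret PD: prob_space "distr M PK Dv"
    using Dv by (rule prob_space_distr)
  interpret PXD: prob_space "distr M PX Xv"
    using Xv by (rule prob_space_distr)
  \<comment> \<open>A product of sigma-finite measures is determined by rectangles, and on
    rectangles the identity is the independence of the two generated sigma-algebras.\<close>
  have joint: "distr M PX Xv \<Otimes>\<^sub>M distr M PK Dv = distr M (PX \<Otimes>\<^sub>M PK) (\<lambda>\<omega>. (Xv \<omega>, Dv \<omega>))"
  proof (rule pair_measure_eqI)
    fix A B assume AB: "A \<in> sets (distr M PX Xv)" "B \<in> sets (distr M PK Dv)"
    have "prob ((Xv -` A \<inter> space M) \<inter> (Dv -` B \<inter> space M)) = prob (Xv -` A \<inter> space M) * prob (Dv -` B \<inter> space M)"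
      using AB XD in_vimage_algebra[of A PX Xv "space M"] in_vimage_algebra[of B PK Dv "space M"]
      by (intro indep_setD) (auto simp: PX_def PK_def Xv_def Dv_def)
    moreover have "(\<lambda>\<omega>. (Xv \<omega>, Dv \<omega>)) -` (A \<times> B) \<inter> space M = (Xv -` A \<inter> space M) \<inter> (Dv -` B \<inter> space M)"
      by auto
    ultimately show "emeasure (distr M PX Xv) A * emeasure (distr M PK Dv) B =
        emeasure (distr M (PX \<Otimes>\<^sub>M PK) (\<lambda>\<omega>. (Xv \<omega>, Dv \<omega>))) (A \<times> B)"
      using AB Xv Dv
      by (simp add: emeasure_distr measurable_Pair emeasure_eq_measure ennreal_mult)
  qed (simp_all add: PD.sigma_finite_measure_axioms PXD.sigma_finite_measure_axioms cong: sets_pair_measure_cong)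
  have comp: "(\<lambda>z. (fst z i, snd z i)) \<in> PX \<Otimes>\<^sub>M PK \<rightarrow>\<^sub>M N \<Otimes>\<^sub>M K" for i
    unfolding PX_def PK_def by measurable
  define J where "J = {z \<in> space (PX \<Otimes>\<^sub>M PK). \<forall>i\<in>I. (fst z i, snd z i) \<in> V}"
  have J: "J \<in> sets (PX \<Otimes>\<^sub>M PK)"
    unfolding J_def using I
  proof (intro sets.sets_Collect_finite_All')
    fix i assume "i \<in> I"
    have "{z \<in> space (PX \<Otimes>\<^sub>M PK). (fst z i, snd z i) \<in> V} =
        (\<lambda>z. (fst z i, snd z i)) -` V \<inter> space (PX \<Otimes>\<^sub>M PK)" by auto
    then show "{z \<in> space (PX \<Otimes>\<^sub>M PK). (fst z i, snd z i) \<in> V} \<in> sets (PX \<Otimes>\<^sub>M PK)"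
      using measurable_sets[OF comp V] by simp
  qed (use False in auto)
  have sec: "{\<omega>' \<in> space M. (x, D i \<omega>') \<in> V} = D i -` (Pair x -` V) \<inter> space M" for x i
    by auto
  have secK: "Pair x -` V \<in> sets K" for x
    using V by (rule sets_Pair1)
  \<comment> \<open>With \<open>X\<close> frozen at \<open>\<omega>\<close>, the section of
    \<open>J\<close> is an intersection of events, one for each \<open>D i\<close>.\<close>
  have slice: "emeasure (distr M PK Dv) (Pair (Xv \<omega>) -` J) =
      ennreal (\<Prod>i\<in>I. prob {\<omega>' \<in> space M. (X i \<omega>, D i \<omega>') \<in> V})" if "\<omega> \<in> space M" for \<omega>
  proof -
    have "Dv -` (Pair (Xv \<omega>) -` J) \<inter> space M = (\<Inter>i\<in>I. D i -` (Pair (X i \<omega>) -` V) \<inter> space M)"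
      using that False measurable_space[OF Xv] measurable_space[OF Dv]
      by (auto simp: J_def space_pair_measure Xv_def Dv_def)
    moreover have "prob (\<Inter>i\<in>I. D i -` (Pair (X i \<omega>) -` V) \<inter> space M) =
        (\<Prod>i\<in>I. prob (D i -` (Pair (X i \<omega>) -` V) \<inter> space M))"
      using D False I secK by (intro indep_varsD[of "\<lambda>_. K" _ UNIV]) auto
    ultimately show ?thesis
      using sets_Pair1[OF J] by (subst emeasure_distr[OF Dv]) (auto simp: emeasure_eq_measure sec)
  qed
  \<comment> \<open>The function gives the measure of the sections of \<open>V\<close> under the law
    of \<open>D i\<close>, so its measurability is part of Fubini's theorem.\<close>
  have meas: "(\<lambda>x. prob {\<omega>' \<in> space M. (x, D i \<omega>') \<in> V}) \<in> borel_measurable N" for i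
  proof -
    interpret Pi: prob_space "distr M K (D i)"
      using Di by (rule prob_space_distr)
    have "(\<lambda>x. enn2real (emeasure (distr M K (D i)) (Pair x -` V))) \<in> borel_measurable N"
      using Pi.measurable_emeasure_Pair[of V N] V
      by (intro borel_measurable_enn2real) (simp cong: measurable_cong_sets sets_pair_measure_cong)
    then show ?thesis
      using secK by (simp add: emeasure_distr[OF Di] emeasure_eq_measure sec)
  qed
  have "emeasure M {\<omega> \<in> space M. \<forall>i\<in>I. (X i \<omega>, D i \<omega>) \<in> V} =
      emeasure (distr M (PX \<Otimes>\<^sub>M PK) (\<lambda>\<omega>. (Xv \<omega>, Dv \<omega>))) J"
    using Xv Dv J measurable_space[OF Xv] measurable_space[OF Dv]
    by (subst emeasure_distr) (auto intro!: arg_cong[where f="emeasure M"] simp: J_def space_pair_measure Xv_def Dv_def)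
  also have "\<dots> = (\<integral>\<^sup>+x. emeasure (distr M PK Dv) (Pair x -` J) \<partial>distr M PX Xv)"
    unfolding joint[symmetric] using J
    by (subst PD.emeasure_pair_measure_alt) (simp_all cong: sets_pair_measure_cong)
  also have "\<dots> = (\<integral>\<^sup>+\<omega>. emeasure (distr M PK Dv) (Pair (Xv \<omega>) -` J) \<partial>M)"
    using J PD.measurable_emeasure_Pair[of J PX]
    by (subst nn_integral_distr[OF Xv]) (simp_all cong: sets_pair_measure_cong)
  also have "\<dots> = (\<integral>\<^sup>+\<omega>. ennreal (\<Prod>i\<in>I. prob {\<omega>' \<in> space M. (X i \<omega>, D i \<omega>') \<in> V}) \<partial>M)"
    by (intro nn_integral_cong slice)
  also have "\<dots> = ennreal (expectation (\<lambda>\<omega>. \<Prod>i\<in>I. prob {\<omega>' \<in> space M. (X i \<omega>, D i \<omega>') \<in> V}))"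
  proof (intro nn_integral_eq_integral integrable_const_bound[where B=1] AE_I2)
    show "random_variable borel (\<lambda>\<omega>. \<Prod>i\<in>I. prob {\<omega>' \<in> space M. (X i \<omega>, D i \<omega>') \<in> V})"
      using measurable_compose[OF X meas] by measurable
  qed (auto simp: abs_prod intro!: prod_le_1 prod_nonneg)
  finally show ?thesis
    by (simp add: emeasure_eq_measure Bochner_Integration.integral_nonneg prod_nonneg)
qed

subsection \<open>The generating functional of a Poisson process\<close>

text \<open>Splitting by the value of \<open>N\<close> turns the expectation into
  \<open>exp (- \<mu>)\<close> times the exponential series at \<open>\<mu> * c\<close>. With
  nonnegative integrals the sum and the integral may be exchanged freely.\<close>

lemma (in prob_space) poisson_probability_generating_function:
  fixes N :: "'a \<Rightarrow> nat"
  assumes N: "random_variable (count_space UNIV) N"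
    and pmf: "\<And>k. prob {\<omega> \<in> space M. N \<omega> = k} = exp (- \<mu>) * \<mu> ^ k / fact k"
    and c: "0 \<le> c" and \<mu>: "0 \<le> \<mu>"
  shows "expectation (\<lambda>\<omega>. c ^ N \<omega>) = exp (- (\<mu> * (1 - c)))"
proof -
  have sets: "{\<omega> \<in> space M. N \<omega> = k} \<in> events" for k
    using N by measurable
  have "(\<lambda>k. (\<mu> * c) ^ k / fact k) sums exp (\<mu> * c)"
    using exp_converges[of "\<mu> * c"] by (simp add: field_simps)
  then have "(\<lambda>k. exp (- \<mu>) * ((\<mu> * c) ^ k / fact k)) sums (exp (- \<mu>) * exp (\<mu> * c))"
    by (rule sums_mult)
  then have sums: "(\<lambda>k. c ^ k * (exp (- \<mu>) * \<mu> ^ k / fact k)) sums exp (- (\<mu> * (1 - c)))"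
    by (simp add: exp_add[symmetric] power_mult_distrib algebra_simps)
  have "(\<integral>\<^sup>+\<omega>. ennreal (c ^ N \<omega>) \<partial>M) =
      (\<integral>\<^sup>+\<omega>. (\<Sum>k. ennreal (c ^ k) * indicator {\<omega> \<in> space M. N \<omega> = k} \<omega>) \<partial>M)"
  proof (rule nn_integral_cong)
    fix \<omega> assume "\<omega> \<in> space M"
    then have "(\<lambda>k. ennreal (c ^ k) * indicator {\<omega> \<in> space M. N \<omega> = k} \<omega>) =
        (\<lambda>k. if k = N \<omega> then ennreal (c ^ k) else 0)"
      by (auto simp: fun_eq_iff)
    then show "ennreal (c ^ N \<omega>) = (\<Sum>k. ennreal (c ^ k) * indicator {\<omega> \<in> space M. N \<omega> = k} \<omega>)"
      using sums_single[of "N \<omega>" "\<lambda>k. ennreal (c ^ k)"] by (simp add: sums_unique)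
  qed
  also have "\<dots> = (\<Sum>k. ennreal (c ^ k) * emeasure M {\<omega> \<in> space M. N \<omega> = k})"
    using sets by (simp add: nn_integral_suminf nn_integral_cmult)
  also have "\<dots> = (\<Sum>k. ennreal (c ^ k * (exp (- \<mu>) * \<mu> ^ k / fact k)))"
    using c by (simp add: emeasure_eq_measure pmf ennreal_mult'[symmetric])
  also have "\<dots> = ennreal (exp (- (\<mu> * (1 - c))))"
    using sums c \<mu> by (intro suminf_ennreal_eq) auto
  finally have "(\<integral>\<^sup>+\<omega>. ennreal (c ^ N \<omega>) \<partial>M) = ennreal (exp (- (\<mu> * (1 - c))))" .
  then show ?thesis
    using c N by (subst integral_eq_nn_integral) (auto intro!: measurable_compose[OF N])
qed

text \<open>The generating functional at a step function: the counts in disjoint sets are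
  independent Poisson variables, so the expectation factorizes into one-variable generating
  functions.\<close>

lemma poisson_pp_generating_function_disjoint:
  fixes Psi :: "'a \<Rightarrow> ('b::euclidean_space) set" and B :: "nat \<Rightarrow> 'b set"
  assumes Psi: "poisson_pp M Psi lam UNIV" and lam: "0 \<le> lam"
    and I: "finite I" and B: "\<And>i. i \<in> I \<Longrightarrow> B i \<in> sets borel" "\<And>i. i \<in> I \<Longrightarrow> bounded (B i)"
    and disj: "disjoint_family_on B I"
    and c: "\<And>i. i \<in> I \<Longrightarrow> 0 \<le> c i \<and> c i \<le> 1"
  shows "(\<lambda>\<omega>. \<Prod>i\<in>I. c i ^ card (Psi \<omega> \<inter> B i)) \<in> borel_measurable M"
    and "(LINT \<omega>|M. (\<Prod>i\<in>I. c i ^ card (Psi \<omega> \<inter> B i))) =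
      exp (- (lam * (\<Sum>i\<in>I. measure lborel (B i) * (1 - c i))))"
proof -
  interpret prob_space M
    using Psi by (simp add: poisson_pp_def)
  have indep: "indep_vars (\<lambda>_. count_space UNIV) (\<lambda>i \<omega>. card (Psi \<omega> \<inter> B i)) I"
    using Psi I B disj by (simp add: poisson_pp_def)
  then have card: "(\<lambda>\<omega>. card (Psi \<omega> \<inter> B i)) \<in> M \<rightarrow>\<^sub>M count_space UNIV" if "i \<in> I" for i
    using that by (auto simp: indep_vars_def)
  have pow: "(\<lambda>\<omega>. c i ^ card (Psi \<omega> \<inter> B i)) \<in> borel_measurable M" if "i \<in> I" for i
    using measurable_compose[OF card[OF that], of "\<lambda>k. c i ^ k" borel] by simp
  then show "(\<lambda>\<omega>. \<Prod>i\<in>I. c i ^ card (Psi \<omega> \<inter> B i)) \<in> borel_measurable M"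
    by simp
  have "(LINT \<omega>|M. (\<Prod>i\<in>I. c i ^ card (Psi \<omega> \<inter> B i))) = (\<Prod>i\<in>I. LINT \<omega>|M. c i ^ card (Psi \<omega> \<inter> B i))"
  proof (cases "I = {}")
    case True
    then show ?thesis by (simp add: prob_space)
  next
    case False
    show ?thesis
    proof (rule indep_vars_lebesgue_integral[OF I])
      show "indep_vars (\<lambda>_. borel) (\<lambda>i \<omega>. c i ^ card (Psi \<omega> \<inter> B i)) I"
        by (rule indep_vars_compose2[OF indep, of "\<lambda>i k. c i ^ k"]) simp
      show "integrable M (\<lambda>\<omega>. c i ^ card (Psi \<omega> \<inter> B i))" if "i \<in> I" for i
        using pow[OF that] c[OF that]
        by (intro integrable_const_bound[where B=1]) (auto simp: power_le_one power_abs)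
    qed
  qed
  also have "\<dots> = (\<Prod>i\<in>I. exp (- (lam * measure lborel (B i) * (1 - c i))))"
    using Psi B c lam card
    by (intro prod.cong poisson_probability_generating_function refl) (auto simp: poisson_pp_def)
  also have "\<dots> = exp (- (lam * (\<Sum>i\<in>I. measure lborel (B i) * (1 - c i))))"
    using I by (simp add: exp_sum[symmetric] sum_negf sum_distrib_left mult.assoc)
  finally show "(LINT \<omega>|M. (\<Prod>i\<in>I. c i ^ card (Psi \<omega> \<inter> B i))) =
      exp (- (lam * (\<Sum>i\<in>I. measure lborel (B i) * (1 - c i))))" .
qed

text \<open>Rounding \<open>g\<close> down to multiples of \<open>1 / Suc m\<close> reduces the
  claim to disjoint level sets. Local finiteness makes each product finite, hence convergent factor
  by factor, and dominated convergence passes to the limit on both sides.\<close>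

lemma poisson_pp_generating_functional:
  fixes Psi :: "'a \<Rightarrow> ('b::euclidean_space) set"
  assumes Psi: "poisson_pp M Psi lam UNIV" and lam: "0 \<le> lam"
    and g [measurable]: "g \<in> borel_measurable borel" and g01: "\<And>x. 0 \<le> g x" "\<And>x. g x \<le> 1"
    and W [measurable]: "W \<in> sets borel" and bdd: "bounded W"
  shows "(\<lambda>\<omega>. \<Prod>x\<in>Psi \<omega> \<inter> W. g x) \<in> borel_measurable M"
    and "(LINT \<omega>|M. (\<Prod>x\<in>Psi \<omega> \<inter> W. g x)) = exp (- (lam * (LINT x:W|lborel. 1 - g x)))"
proof -
  interpret prob_space M
    using Psi by (simp add: poisson_pp_def)
  have finPsi: "finite (Psi \<omega> \<inter> W)" if "\<omega> \<in> space M" for \<omega>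
    using Psi that bdd by (simp add: poisson_pp_def)
  \<comment> \<open>\<open>c m (h m x)\<close> is \<open>g x\<close> rounded down to a multiple of
    \<open>1 / Suc m\<close>, and \<open>B m k\<close> is the part of \<open>W\<close> at level
    \<open>k\<close>.\<close>
  define h where "h m x = nat \<lfloor>real (Suc m) * g x\<rfloor>" for m x
  define c where "c m k = real k / real (Suc m)" for m k :: nat
  define B where "B m k = {x \<in> W. h m x = k}" for m k
  have h_le: "h m x \<le> Suc m" for m x
  proof -
    have "real (Suc m) * g x \<le> real (Suc m)"
      using g01[of x] by (intro mult_left_le) auto
    then show ?thesis unfolding h_def by linarith
  qed
  have h_bounds: "real (h m x) \<le> real (Suc m) * g x" "real (Suc m) * g x \<le> real (h m x) + 1" for m x
  proof -
    have "0 \<le> real (Suc m) * g x" using g01[of x] by simp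
    then show "real (h m x) \<le> real (Suc m) * g x" "real (Suc m) * g x \<le> real (h m x) + 1"
      unfolding h_def by linarith+
  qed
  have lim: "(\<lambda>m. c m (h m x)) \<longlonglongrightarrow> g x" for x
  proof (rule real_tendsto_sandwich)
    show "\<forall>\<^sub>F m in sequentially. g x - 1 / real (Suc m) \<le> c m (h m x)"
    proof (intro always_eventually allI)
      fix m
      have "g x \<le> (real (h m x) + 1) / real (Suc m)"
        using h_bounds(2)[of m x] by (subst pos_le_divide_eq) (auto simp: mult.commute)
      then show "g x - 1 / real (Suc m) \<le> c m (h m x)"
        by (simp add: c_def add_divide_distrib)
    qed
    show "\<forall>\<^sub>F m in sequentially. c m (h m x) \<le> g x"
      using h_bounds(1)[of _ x]
      by (intro always_eventually allI) (simp add: c_def pos_divide_le_eq mult.commute del: of_nat_Suc)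
    show "(\<lambda>m. g x - 1 / real (Suc m)) \<longlonglongrightarrow> g x"
      using tendsto_diff[OF tendsto_const LIMSEQ_inverse_real_of_nat, of "g x"] by (simp add: inverse_eq_divide)
  qed simp
  have c01: "0 \<le> c m k" "k \<le> Suc m \<Longrightarrow> c m k \<le> 1" for m k
    by (auto simp: c_def)
  have [measurable]: "h m \<in> borel \<rightarrow>\<^sub>M count_space UNIV" for m
    unfolding h_def by measurable
  have B: "B m k \<in> sets borel" "bounded (B m k)" for m k
  proof -
    show "B m k \<in> sets borel" unfolding B_def by measurable
    show "bounded (B m k)" using bdd by (rule bounded_subset) (auto simp: B_def)
  qed
  \<comment> \<open>The index \<open>Suc m\<close> has to be included: it is the level of the points
    with \<open>g x = 1\<close>.\<close>
  have disj: "disjoint_family_on (B m) {..Suc m}" for m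
    by (auto simp: disjoint_family_on_def B_def)
  note gf = poisson_pp_generating_function_disjoint[OF Psi lam finite_atMost B disj]
  have prod_eq: "(\<Prod>k\<le>Suc m. c m k ^ card (Psi \<omega> \<inter> B m k)) = (\<Prod>x\<in>Psi \<omega> \<inter> W. c m (h m x))"
    if "\<omega> \<in> space M" for m \<omega>
  proof -
    have "(\<Prod>x\<in>Psi \<omega> \<inter> W. c m (h m x)) =
        (\<Prod>k\<le>Suc m. \<Prod>x | x \<in> Psi \<omega> \<inter> W \<and> h m x = k. c m (h m x))"
      using finPsi[OF that] h_le by (intro prod.group[symmetric]) auto
    also have "\<dots> = (\<Prod>k\<le>Suc m. c m k ^ card (Psi \<omega> \<inter> B m k))"
    proof (intro prod.cong refl)
      fix k
      have "{x. x \<in> Psi \<omega> \<inter> W \<and> h m x = k} = Psi \<omega> \<inter> B m k" by (auto simp: B_def)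
      then show "(\<Prod>x | x \<in> Psi \<omega> \<inter> W \<and> h m x = k. c m (h m x)) = c m k ^ card (Psi \<omega> \<inter> B m k)"
        by (simp add: B_def)
    qed
    finally show ?thesis by simp
  qed
  have measm: "(\<lambda>\<omega>. \<Prod>x\<in>Psi \<omega> \<inter> W. c m (h m x)) \<in> borel_measurable M" for m
  proof -
    have "(\<lambda>\<omega>. \<Prod>k\<le>Suc m. c m k ^ card (Psi \<omega> \<inter> B m k)) \<in> borel_measurable M"
      using c01 by (intro gf(1)) auto
    then show ?thesis
      using prod_eq by (subst (asm) measurable_cong) (simp_all del: prod.atMost_Suc)
  qed
  show meas: "(\<lambda>\<omega>. \<Prod>x\<in>Psi \<omega> \<inter> W. g x) \<in> borel_measurable M"
    by (rule borel_measurable_LIMSEQ_real[where u="\<lambda>m \<omega>. \<Prod>x\<in>Psi \<omega> \<inter> W. c m (h m x)"])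
      (intro tendsto_prod lim measm)+
  have fW: "emeasure lborel W < \<infinity>"
    using bdd by (rule emeasure_bounded_finite)
  have Em: "(LINT \<omega>|M. (\<Prod>x\<in>Psi \<omega> \<inter> W. c m (h m x))) = exp (- (lam * (LINT x:W|lborel. 1 - c m (h m x))))" for m
  proof -
    have "(LINT \<omega>|M. (\<Prod>x\<in>Psi \<omega> \<inter> W. c m (h m x))) =
        (LINT \<omega>|M. (\<Prod>k\<le>Suc m. c m k ^ card (Psi \<omega> \<inter> B m k)))"
      by (intro Bochner_Integration.integral_cong refl) (simp only: prod_eq)
    also have "\<dots> = exp (- (lam * (\<Sum>k\<le>Suc m. measure lborel (B m k) * (1 - c m k))))"
      using c01 by (intro gf(2)) auto
    \<comment> \<open>The sum becomes one integral over \<open>W\<close>, since at each point of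
      \<open>W\<close> only its own level contributes.\<close>
    also have "(\<Sum>k\<le>Suc m. measure lborel (B m k) * (1 - c m k)) =
        (\<Sum>k\<le>Suc m. LINT x|lborel. indicator (B m k) x * (1 - c m k))"
      by (simp add: B)
    also have "\<dots> = (LINT x|lborel. (\<Sum>k\<le>Suc m. indicator (B m k) x * (1 - c m k)))"
      using B emeasure_bounded_finite[OF B(2)] by (intro Bochner_Integration.integral_sum[symmetric]) auto
    also have "\<dots> = (LINT x:W|lborel. 1 - c m (h m x))"
      unfolding set_lebesgue_integral_def
    proof (intro Bochner_Integration.integral_cong refl)
      fix x
      have "(\<Sum>k\<le>Suc m. indicator (B m k) x * (1 - c m k)) =
          (\<Sum>k\<le>Suc m. if k = h m x then indicator W x * (1 - c m k) else 0)"
        by (intro sum.cong refl) (auto simp: B_def indicator_def)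
      then show "(\<Sum>k\<le>Suc m. indicator (B m k) x * (1 - c m k)) = indicator W x *\<^sub>R (1 - c m (h m x))"
        using h_le[of m x] by simp
    qed
    finally show ?thesis .
  qed
  have "(\<lambda>m. LINT \<omega>|M. (\<Prod>x\<in>Psi \<omega> \<inter> W. c m (h m x))) \<longlonglongrightarrow> (LINT \<omega>|M. (\<Prod>x\<in>Psi \<omega> \<inter> W. g x))"
  proof (rule integral_dominated_convergence[where w="\<lambda>_. 1"])
    show "AE \<omega> in M. (\<lambda>m. \<Prod>x\<in>Psi \<omega> \<inter> W. c m (h m x)) \<longlonglongrightarrow> (\<Prod>x\<in>Psi \<omega> \<inter> W. g x)"
      by (intro AE_I2 tendsto_prod lim)
    show "AE \<omega> in M. norm (\<Prod>x\<in>Psi \<omega> \<inter> W. c m (h m x)) \<le> 1" for m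
      using c01 h_le by (intro AE_I2) (auto simp: abs_prod intro!: prod_le_1)
  qed (use meas measm in auto)
  moreover have "(\<lambda>m. LINT x:W|lborel. 1 - c m (h m x)) \<longlonglongrightarrow> (LINT x:W|lborel. 1 - g x)"
    unfolding set_lebesgue_integral_def
  proof (rule integral_dominated_convergence[where w="indicator W"])
    show "AE x in lborel. (\<lambda>m. indicator W x *\<^sub>R (1 - c m (h m x))) \<longlonglongrightarrow> indicator W x *\<^sub>R (1 - g x)"
      by (intro AE_I2 tendsto_intros lim)
    show "AE x in lborel. norm (indicator W x *\<^sub>R (1 - c m (h m x))) \<le> (indicator W x :: real)" for m
      using c01(1)[of m] c01(2)[OF h_le[of m]] by (intro AE_I2) (auto simp: indicator_def)
    show "(\<lambda>x. indicator W x *\<^sub>R (1 - c m (h m x))) \<in> borel_measurable lborel" for m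
      unfolding c_def by measurable
  qed (use fW in auto)
  then have "(\<lambda>m. exp (- (lam * (LINT x:W|lborel. 1 - c m (h m x))))) \<longlonglongrightarrow>
      exp (- (lam * (LINT x:W|lborel. 1 - g x)))"
    by (intro tendsto_intros)
  ultimately show "(LINT \<omega>|M. (\<Prod>x\<in>Psi \<omega> \<inter> W. g x)) = exp (- (lam * (LINT x:W|lborel. 1 - g x)))"
    unfolding Em by (rule LIMSEQ_unique)
qed

subsection \<open>Rotation invariance and polar coordinates\<close>

text \<open>Both sides are translation-invariant measures of \<open>A\<close> that agree on the unit ball, so the usual
  Fubini argument for uniqueness of Haar measure applies.\<close>
lemma emeasure_lborel_vimage_orthogonal:
  fixes f :: "'b::euclidean_space \<Rightarrow> 'b"
  assumes f: "orthogonal_transformation f" and A [measurable]: "A \<in> sets borel"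
  shows "emeasure lborel (f -` A) = emeasure lborel A"
proof -
  define U where "U = ball (0::'b) 1"
  have U [measurable]: "U \<in> sets borel" by (simp add: U_def)
  have lin: "linear f" and surj: "surj f"
    using f by (auto simp: orthogonal_transformation_linear orthogonal_transformation_surj)
  have f_meas [measurable]: "f \<in> borel \<rightarrow>\<^sub>M borel"
    using lin by (intro borel_measurable_continuous_onI linear_continuous_on linear_conv_bounded_linear[THEN iffD1])
  have trans: "emeasure lborel {x. x + y \<in> C} = emeasure lborel C" if "C \<in> sets borel" for C and y :: 'b
  proof -
    have "emeasure lborel C = emeasure (distr lborel borel ((+) y)) C"
      by (simp add: lborel_distr_plus)
    also have "\<dots> = emeasure lborel {x. x + y \<in> C}"
      using that by (subst emeasure_distr) (auto simp: vimage_def add.commute)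
    finally show ?thesis by simp
  qed
  have shift: "emeasure lborel {x. f x + y \<in> A} = emeasure lborel (f -` A)" for y
  proof -
    obtain w where w: "y = f w" using surj by (metis surjD)
    have "{x. f x + y \<in> A} = {x. x + w \<in> f -` A}"
      using lin by (auto simp: w linear_add)
    then show ?thesis
      using trans[of "f -` A" w] measurable_sets[OF f_meas A] by simp
  qed
  \<comment> \<open>Because \<open>f\<close> is a surjective isometry, the set is a unit ball about
    the preimage of \<open>y\<close>, that is, a translate of \<open>U\<close>.\<close>
  have UU: "emeasure lborel {x. y - f x \<in> U} = emeasure lborel U" for y
  proof -
    obtain w where w: "y = f w" using surj by (metis surjD)
    have "y - f x \<in> U \<longleftrightarrow> dist w x < 1" for x
      using f lin by (simp add: w U_def linear_diff[symmetric] orthogonal_transformation_norm dist_norm)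
    then have "{x. y - f x \<in> U} = ball w 1"
      by (simp add: set_eq_iff)
    moreover have "x + (- w) \<in> U \<longleftrightarrow> dist w x < 1" for x
      by (simp add: U_def dist_norm norm_minus_commute[of w x])
    then have "{x. x + (- w) \<in> U} = ball w 1"
      by (simp only: set_eq_iff mem_Collect_eq mem_ball simp_thms)
    ultimately show ?thesis using trans[of U "- w"] by simp
  qed
  \<comment> \<open>The double integral of \<open>indicator U y * indicator A (f x + y)\<close> is
    evaluated in both orders: integrating over \<open>x\<close> first gives the left side.\<close>
  have "emeasure lborel (f -` A) * emeasure lborel U =
      (\<integral>\<^sup>+y. indicator U y * emeasure lborel (f -` A) \<partial>lborel)"
    by (simp add: nn_integral_multc mult.commute)
  also have "\<dots> = (\<integral>\<^sup>+y. (\<integral>\<^sup>+x. indicator U y * indicator A (f x + y) \<partial>lborel) \<partial>lborel)"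
  proof (rule nn_integral_cong)
    fix y :: 'b
    have "(\<integral>\<^sup>+x. indicator A (f x + y) \<partial>lborel) = (\<integral>\<^sup>+x. indicator {x. f x + y \<in> A} x \<partial>lborel)"
      by (intro nn_integral_cong) (auto simp: indicator_def)
    also have "\<dots> = emeasure lborel {x. f x + y \<in> A}"
      by (intro nn_integral_indicator) measurable
    finally show "indicator U y * emeasure lborel (f -` A) =
        (\<integral>\<^sup>+x. indicator U y * indicator A (f x + y) \<partial>lborel)"
      by (simp add: nn_integral_cmult shift)
  qed
  also have "\<dots> = (\<integral>\<^sup>+x. (\<integral>\<^sup>+y. indicator U y * indicator A (f x + y) \<partial>lborel) \<partial>lborel)"
    by (intro lborel_pair.Fubini') measurable
  \<comment> \<open>Translating \<open>y\<close> by \<open>f x\<close> moves the dependence on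
    \<open>x\<close> from \<open>A\<close> to \<open>U\<close>, where \<open>UU\<close> applies
    after a second exchange.\<close>
  also have "\<dots> = (\<integral>\<^sup>+x. (\<integral>\<^sup>+y. indicator U (y - f x) * indicator A y \<partial>lborel) \<partial>lborel)"
  proof (rule nn_integral_cong)
    fix x :: 'b
    have "(\<integral>\<^sup>+y. indicator U (y - f x) * indicator A y \<partial>lborel) =
        (\<integral>\<^sup>+y. indicator U (y - f x) * indicator A y \<partial>distr lborel borel ((+) (f x)))"
      by (simp add: lborel_distr_plus)
    also have "\<dots> = (\<integral>\<^sup>+y. indicator U y * indicator A (f x + y) \<partial>lborel)"
      by (subst nn_integral_distr) simp_all
    finally show "(\<integral>\<^sup>+y. indicator U y * indicator A (f x + y) \<partial>lborel) =
        (\<integral>\<^sup>+y. indicator U (y - f x) * indicator A y \<partial>lborel)" by simp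
  qed
  also have "\<dots> = (\<integral>\<^sup>+y. (\<integral>\<^sup>+x. indicator U (y - f x) * indicator A y \<partial>lborel) \<partial>lborel)"
    by (intro lborel_pair.Fubini') measurable
  also have "\<dots> = (\<integral>\<^sup>+y. emeasure lborel U * indicator A y \<partial>lborel)"
  proof (rule nn_integral_cong)
    fix y :: 'b
    have "(\<integral>\<^sup>+x. indicator U (y - f x) \<partial>lborel) = (\<integral>\<^sup>+x. indicator {x. y - f x \<in> U} x \<partial>lborel)"
      by (intro nn_integral_cong) (auto simp: indicator_def)
    also have "\<dots> = emeasure lborel {x. y - f x \<in> U}"
      by (intro nn_integral_indicator) measurable
    finally show "(\<integral>\<^sup>+x. indicator U (y - f x) * indicator A y \<partial>lborel) =
        emeasure lborel U * indicator A y"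
      by (simp add: nn_integral_multc UU)
  qed
  also have "\<dots> = emeasure lborel A * emeasure lborel U"
    by (subst nn_integral_cmult) (simp_all add: mult.commute[of "emeasure lborel U"])
  finally have "emeasure lborel U * emeasure lborel (f -` A) = emeasure lborel U * emeasure lborel A"
    by (simp add: mult.commute)
  moreover have "emeasure lborel U \<noteq> 0"
    using content_ball_pos[of 1 "0::'b"] by (auto simp: U_def measure_def)
  moreover have "emeasure lborel U \<noteq> \<top>"
    using emeasure_lborel_ball_finite[of "0::'b" 1] by (simp add: U_def)
  ultimately show ?thesis
    by (simp add: ennreal_mult_cancel_left)
qed

text \<open>\<open>lens_vol\<close> places the second centre on a fixed axis. An orthogonal map
  taking that centre to \<open>x\<close> preserves both volume and the ball about the
  origin.\<close>

lemma measure_balls_eq_lens_vol: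
  fixes x :: "real ^ 'n"
  shows "measure lborel (ball 0 r \<inter> ball x s) = lens_vol TYPE(real ^ 'n) r s (norm x)"
proof -
  define e where "e = (SOME b. b \<in> (Basis :: (real ^ 'n) set))"
  have "e \<in> Basis"
    unfolding e_def by (rule someI_ex) (use nonempty_Basis in blast)
  then have e: "norm e = 1" by (rule norm_Basis)
  obtain f where f: "orthogonal_transformation f" "f (norm x *\<^sub>R e) = x"
  proof (cases "x = 0")
    case True
    then show ?thesis using that[of id] by (simp add: orthogonal_transformation_id id_def)
  next
    case False
    obtain f where f: "orthogonal_transformation f" "f e = x /\<^sub>R norm x"
      using orthogonal_transformation_exists_1[OF e, of "x /\<^sub>R norm x"] False by auto
    then show ?thesis
      using that[of f] False by (simp add: orthogonal_transformation_linear linear_scale)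
  qed
  have "f y \<in> ball 0 r \<inter> ball x s \<longleftrightarrow> y \<in> ball 0 r \<inter> ball (norm x *\<^sub>R e) s" for y
  proof -
    have "norm (f y) = norm y" using f(1) by (rule orthogonal_transformation_norm)
    moreover have "dist x (f y) = dist (norm x *\<^sub>R e) y"
      using f orthogonal_transformation_isometry[of f] by metis
    ultimately show ?thesis by simp
  qed
  then have "f -` (ball 0 r \<inter> ball x s) = ball 0 r \<inter> ball (norm x *\<^sub>R e) s"
    by blast
  then show ?thesis
    using emeasure_lborel_vimage_orthogonal[OF f(1), of "ball 0 r \<inter> ball x s"]
    by (simp add: lens_vol_def e_def[symmetric] measure_def)
qed

section \<open>Ball volumes and integrals of radial functions\<close>

lemma measure_ball_conv_unit_ball:
  fixes c :: "'b::euclidean_space"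
  assumes "0 \<le> r"
  shows "measure lborel (ball c r) = unit_ball_volume TYPE('b) * r ^ DIM('b)"
  using content_ball_conv_unit_ball[OF assms, of c] by (simp add: unit_ball_volume_def)

text \<open>Under Lebesgue measure on the ball, the norm has density
  \<open>v * n * t ^ (n - 1)\<close> on \<open>{0..R}\<close>: the image measure
  \<open>\<mu>\<close> and the measure \<open>\<nu>\<close> with that density agree on all
  half-lines, by the volume of a shell and by integrating the density.\<close>

lemma integral_radial:
  fixes g :: "real \<Rightarrow> real"
  assumes g [measurable]: "g \<in> borel_measurable borel" and R: "0 \<le> R"
  shows "(LINT x:cball 0 R|lborel. g (norm (x :: 'b::euclidean_space))) =
    unit_ball_volume TYPE('b) * real DIM('b) * (LINT t:{0..R}|lborel. g t * t ^ (DIM('b) - 1))"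
proof -
  define n where "n = DIM('b)"
  define v where "v = unit_ball_volume TYPE('b)"
  have n: "0 < n" by (simp add: n_def)
  have v: "0 \<le> v" by (simp add: v_def unit_ball_volume_def)
  have cball: "emeasure lborel (cball (0::'b) s) = ennreal (v * s ^ n)" if "0 \<le> s" for s
    using measure_ball_conv_unit_ball[OF that, of "0::'b"] emeasure_lborel_cball_finite[of "0::'b" s]
    by (simp add: emeasure_eq_ennreal_measure content_cball_conv_ball v_def n_def)
  define \<mu> where "\<mu> = distr (density lborel (\<lambda>x::'b. ennreal (indicator (cball 0 R) x))) borel norm"
  define \<nu> where "\<nu> = density lborel (\<lambda>t. ennreal (indicator {0..R} t * (v * real n * t ^ (n - 1))))"
  \<comment> \<open>For negative \<open>x\<close> every point has norm above \<open>x\<close>;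
    \<open>max 0 x\<close> makes this the case of inner radius 0.\<close>
  have \<mu>: "emeasure \<mu> {x<..} = ennreal (v * (R ^ n - max 0 x ^ n))" if "x \<le> R" for x
  proof -
    have "emeasure \<mu> {x<..} = emeasure (density lborel (\<lambda>x::'b. ennreal (indicator (cball 0 R) x))) {y. x < norm y}"
      unfolding \<mu>_def by (subst emeasure_distr) (auto intro!: arg_cong2[where f=emeasure])
    also have "\<dots> = (\<integral>\<^sup>+y. indicator (cball 0 R \<inter> {y::'b. x < norm y}) y \<partial>lborel)"
      by (subst emeasure_density) (auto intro!: nn_integral_cong simp del: nn_integral_indicator simp: indicator_def)
    also have "\<dots> = emeasure lborel (cball 0 R \<inter> {y::'b. x < norm y})"
      by (intro nn_integral_indicator) measurable
    also have "\<dots> = ennreal (v * (R ^ n - max 0 x ^ n))"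
    proof (cases "0 \<le> x")
      case True
      have "cball 0 R \<inter> {y::'b. x < norm y} = cball 0 R - cball 0 x" by auto
      moreover have "emeasure lborel (cball 0 R - cball (0::'b) x) = ennreal (v * R ^ n) - ennreal (v * x ^ n)"
        using True R that cball[OF R] cball[OF True] by (subst emeasure_Diff) auto
      ultimately show ?thesis
        using True v by (simp add: ennreal_minus right_diff_distrib)
    next
      case False
      then have "cball 0 R \<inter> {y::'b. x < norm y} = cball 0 R"
        using order_less_le_trans[OF _ norm_ge_zero, of x] by auto
      moreover have "max 0 x = 0" using False by auto
      ultimately show ?thesis using cball[OF R] by (simp add: zero_power[OF n])
    qed
    finally show ?thesis .
  qed
  have \<nu>: "emeasure \<nu> {x<..} = ennreal (v * (R ^ n - max 0 x ^ n))" if "x \<le> R" for x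
  proof -
    have "emeasure \<nu> {x<..} = (\<integral>\<^sup>+t. ennreal (indicator {0..R} t * (v * real n * t ^ (n - 1))) * indicator {x<..} t \<partial>lborel)"
      unfolding \<nu>_def by (subst emeasure_density) auto
    \<comment> \<open>Closing the interval changes it at most at the null point
      \<open>x\<close>.\<close>
    also have "\<dots> = (\<integral>\<^sup>+t. ennreal (v * real n * t ^ (n - 1)) * indicator {max 0 x..R} t \<partial>lborel)"
      using AE_lborel_singleton[of x]
      by (intro nn_integral_cong_AE) (auto elim!: eventually_mono simp: indicator_def)
    also have "\<dots> = ennreal (v * R ^ n - v * max 0 x ^ n)"
      using v R that
      by (intro nn_integral_FTC_Icc) (auto intro!: derivative_eq_intros simp: max_def split: if_splits)
    finally show ?thesis by (simp add: right_diff_distrib)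
  qed
  have "\<mu> = \<nu>"
  proof (rule measure_eqI_lessThan)
    fix x
    have *: "emeasure \<mu> {x<..} = 0" "emeasure \<nu> {x<..} = 0" if "x > R"
    proof -
      have le: "{x<..} \<subseteq> {R<..}" using that by auto
      have "emeasure \<mu> {R<..} = 0" "emeasure \<nu> {R<..} = 0" using \<mu>[of R] \<nu>[of R] R by auto
      then show "emeasure \<mu> {x<..} = 0" "emeasure \<nu> {x<..} = 0"
        using emeasure_mono[OF le, of \<mu>] emeasure_mono[OF le, of \<nu>] by (auto simp: \<mu>_def \<nu>_def)
    qed
    show "emeasure \<mu> {x<..} < \<infinity>" using \<mu>[of x] *(1) by (cases "x \<le> R") auto
    show "emeasure \<mu> {x<..} = emeasure \<nu> {x<..}" using \<mu>[of x] \<nu>[of x] * by (cases "x \<le> R") auto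
  qed (auto simp: \<mu>_def \<nu>_def)
  have "(LINT x:cball 0 R|lborel. g (norm (x::'b))) = (LINT t|\<mu>. g t)"
    unfolding \<mu>_def set_lebesgue_integral_def
    by (subst integral_distr; (subst integral_density)?) (auto intro!: borel_measurable_indicator)
  also have "\<dots> = (LINT t|lborel. (indicator {0..R} t * (v * real n * t ^ (n - 1))) *\<^sub>R g t)"
    unfolding \<open>\<mu> = \<nu>\<close> \<nu>_def using v by (subst integral_density) (auto simp: indicator_def)
  also have "\<dots> = v * real n * (LINT t:{0..R}|lborel. g t * t ^ (n - 1))"
    unfolding set_lebesgue_integral_def
    unfolding integral_mult_right_zero[symmetric]
    by (intro Bochner_Integration.integral_cong) auto
  finally show ?thesis by (simp add: n_def v_def)
qed

section \<open>Volume of the intersection of two balls\<close>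

lemma lens_vol_borel_measurable [measurable]:
  "lens_vol TYPE('b::euclidean_space) r s \<in> borel_measurable borel"
proof -
  define e where "e = (SOME b. b \<in> (Basis :: 'b set))"
  \<comment> \<open>The lens at distance \<open>t\<close> is the section of the open set
    \<open>Q\<close> at \<open>t\<close>, and the measure of sections is measurable.\<close>
  define Q where "Q = {p :: real \<times> 'b. snd p \<in> ball 0 r \<inter> ball (fst p *\<^sub>R e) s}"
  have "open Q"
    unfolding Q_def mem_ball Int_iff by (intro open_Collect_conj open_Collect_less continuous_intros)
  then have "Q \<in> sets (borel \<Otimes>\<^sub>M borel)"
    by (simp only: borel_prod borel_open)
  then have "Q \<in> sets (borel \<Otimes>\<^sub>M (lborel :: 'b measure))"
    by (simp cong: sets_pair_measure_cong)
  then have "(\<lambda>t. enn2real (emeasure lborel (Pair t -` Q))) \<in> borel_measurable borel"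
    by (intro borel_measurable_enn2real lborel.measurable_emeasure_Pair)
  also have "(\<lambda>t. enn2real (emeasure lborel (Pair t -` Q))) = lens_vol TYPE('b) r s"
    by (auto simp: lens_vol_def e_def[symmetric] Q_def measure_def fun_eq_iff
        intro!: arg_cong[where f="\<lambda>S. enn2real (emeasure lborel S)"])
  finally show ?thesis .
qed

lemma lens_vol_nonneg: "0 \<le> lens_vol TYPE('b::euclidean_space) r s x"
  by (simp add: lens_vol_def)

lemma lens_vol_disjoint:
  assumes "r + s \<le> x"
  shows "lens_vol TYPE('b::euclidean_space) r s x = 0"
proof -
  have "norm (SOME b. b \<in> (Basis :: 'b set)) = 1"
    by (rule norm_Basis[OF someI_ex]) (use nonempty_Basis in blast)
  then have "ball (0::'b) r \<inter> ball (x *\<^sub>R (SOME b. b \<in> Basis)) s = {}"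
    using assms by (intro disjoint_ballI) simp
  then show ?thesis by (simp add: lens_vol_def)
qed

lemma lens_vol_nested:
  assumes "0 \<le> x" "x \<le> \<bar>r - s\<bar>" "0 \<le> r" "0 \<le> s"
  shows "lens_vol TYPE('b::euclidean_space) r s x = unit_ball_volume TYPE('b) * min r s ^ DIM('b)"
proof -
  define e where "e = (SOME b. b \<in> (Basis :: 'b set))"
  have e: "norm e = 1"
    unfolding e_def by (rule norm_Basis[OF someI_ex]) (use nonempty_Basis in blast)
  show ?thesis
  proof (cases "r \<le> s")
    case True
    have "ball 0 r \<subseteq> ball (x *\<^sub>R e) s"
      using assms True e by (subst ball_subset_ball_iff) auto
    then have "ball 0 r \<inter> ball (x *\<^sub>R e) s = ball 0 r" by blast
    then show ?thesis
      using True assms by (simp add: lens_vol_def e_def[symmetric] measure_ball_conv_unit_ball)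
  next
    case False
    have "ball (x *\<^sub>R e) s \<subseteq> ball 0 r"
      using assms False e by (subst ball_subset_ball_iff) auto
    then have "ball 0 r \<inter> ball (x *\<^sub>R e) s = ball (x *\<^sub>R e) s" by blast
    then show ?thesis
      using False assms by (simp add: lens_vol_def e_def[symmetric] measure_ball_conv_unit_ball)
  qed
qed

text \<open>The left side is the region that the daughters of a parent at \<open>x\<close> must
  avoid. The ball is closed because the contact event is \<open>\<le> r\<close>; its sphere is a
  null set, and translation by \<open>x\<close> gives the lens.\<close>

lemma measure_ball_inter_cball_minus:
  fixes x :: "real ^ 'n"
  shows "measure lborel (cball (- x) r \<inter> ball 0 s) = lens_vol TYPE(real ^ 'n) r s (norm x)"
proof -
  have "emeasure lborel (cball (- x) r \<inter> ball 0 s) = emeasure lborel (ball (- x) r \<inter> ball 0 s)"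
  proof (rule emeasure_eq_AE)
    have "sphere (- x) r \<in> null_sets lborel"
      using negligible_sphere[of "- x" r] by (simp add: negligible_iff_null_sets null_sets_completion_iff)
    then have "AE y in lborel. y \<notin> sphere (- x) r"
      by (rule AE_not_in)
    then show "AE y in lborel. y \<in> cball (- x) r \<inter> ball 0 s \<longleftrightarrow> y \<in> ball (- x) r \<inter> ball 0 s"
      by (rule eventually_mono) auto
  qed auto
  also have "ball (- x) r \<inter> ball 0 s = (+) x -` (ball 0 r \<inter> ball x s)"
    by (auto simp: dist_norm) (simp_all add: norm_minus_commute add.commute)?
  also have "emeasure lborel \<dots> = emeasure (distr lborel borel ((+) x)) (ball 0 r \<inter> ball x s)"
    by (subst emeasure_distr) auto
  also have "\<dots> = emeasure lborel (ball 0 r \<inter> ball x s)"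
    by (simp add: lborel_distr_plus)
  finally show ?thesis
    by (simp add: measure_def measure_balls_eq_lens_vol[symmetric])
qed

text \<open>The term without \<open>q\<close> integrates to \<open>(r + s) ^ n / n\<close>. On
  \<open>{0..\<bar>r - s\<bar>}\<close> the balls are nested, so \<open>q\<close> is constant and
  integrates explicitly as well. Integrability lets the Lebesgue integral be read as the gauge
  integral \<open>integral\<close>.\<close>

lemma integral_lens_split:
  fixes lam r s :: real
  assumes lam: "0 \<le> lam" and r: "0 < r" and s: "0 < s"
  defines "n \<equiv> DIM('b::euclidean_space)"
    and "q \<equiv> \<lambda>t. exp (- lam * lens_vol TYPE('b) r s t)"
  shows "set_integrable lborel {0..r + s} (\<lambda>t. (1 - q t) * t ^ (n - 1))"
    and "real n * integral {0..r + s} (\<lambda>t. (1 - q t) * t ^ (n - 1)) =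
      (r + s) ^ n - \<bar>r - s\<bar> ^ n * exp (- lam * unit_ball_volume TYPE('b) * min r s ^ n)
      - real n * integral {\<bar>r - s\<bar>..r + s} (\<lambda>t. q t * t ^ (n - 1))"
proof -
  have n: "0 < n" by (simp add: n_def)
  have q_meas [measurable]: "q \<in> borel_measurable borel"
    unfolding q_def by measurable
  have q01: "0 \<le> q t" "q t \<le> 1" for t
    using lam by (auto simp: q_def lens_vol_nonneg)
  have pow: "norm (u * t ^ (n - 1)) \<le> (r + s) ^ (n - 1)" if "\<bar>u\<bar> \<le> 1" "0 \<le> t" "t \<le> r + s" for t u :: real
  proof -
    have "\<bar>u\<bar> * t ^ (n - 1) \<le> 1 * (r + s) ^ (n - 1)"
      using that by (intro mult_mono power_mono) auto
    then show ?thesis using that by (simp add: abs_mult)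
  qed
  show int1: "set_integrable lborel {0..r + s} (\<lambda>t. (1 - q t) * t ^ (n - 1))"
    unfolding set_integrable_def
    using q01 r s by (intro integrableI_bounded_set_indicator[where B="(r + s) ^ (n - 1)"] AE_I2 impI pow) auto
  have "set_integrable lborel {0..r + s} (\<lambda>t. q t * t ^ (n - 1))"
    unfolding set_integrable_def
    using q01 r s by (intro integrableI_bounded_set_indicator[where B="(r + s) ^ (n - 1)"] AE_I2 impI pow) auto
  then have int2: "(\<lambda>t. q t * t ^ (n - 1)) integrable_on {0..r + s}"
    by (rule set_borel_integral_eq_integral)
  have mono: "((\<lambda>t. t ^ (n - 1)) has_integral (b ^ n / real n)) {0..b}" if "0 \<le> b" for b :: real
  proof -
    have "((\<lambda>t. t ^ (n - 1)) has_integral (b ^ n / real n - 0 ^ n / real n)) {0..b}"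
      using that n by (intro fundamental_theorem_of_calculus)
        (auto intro!: derivative_eq_intros simp flip: has_real_derivative_iff_has_vector_derivative)
    then show ?thesis using n by (simp add: zero_power)
  qed
  have "integral {0..\<bar>r - s\<bar>} (\<lambda>t. q t * t ^ (n - 1)) =
      integral {0..\<bar>r - s\<bar>} (\<lambda>t. exp (- lam * unit_ball_volume TYPE('b) * min r s ^ n) * t ^ (n - 1))"
    using r s by (intro integral_cong) (simp add: q_def n_def lens_vol_nested)
  also have "\<dots> = exp (- lam * unit_ball_volume TYPE('b) * min r s ^ n) * (\<bar>r - s\<bar> ^ n / real n)"
    using mono[of "\<bar>r - s\<bar>"] by (simp add: integral_unique)
  finally have inner: "real n * integral {0..\<bar>r - s\<bar>} (\<lambda>t. q t * t ^ (n - 1)) =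
      \<bar>r - s\<bar> ^ n * exp (- lam * unit_ball_volume TYPE('b) * min r s ^ n)"
    using n by simp
  have split: "integral {0..r + s} (\<lambda>t. q t * t ^ (n - 1)) =
      integral {0..\<bar>r - s\<bar>} (\<lambda>t. q t * t ^ (n - 1)) + integral {\<bar>r - s\<bar>..r + s} (\<lambda>t. q t * t ^ (n - 1))"
    using r s int2 by (intro Henstock_Kurzweil_Integration.integral_combine[symmetric]) auto
  have "integral {0..r + s} (\<lambda>t. (1 - q t) * t ^ (n - 1)) =
      integral {0..r + s} (\<lambda>t. t ^ (n - 1) - q t * t ^ (n - 1))"
    by (simp add: left_diff_distrib)
  also have "\<dots> = (r + s) ^ n / real n - integral {0..r + s} (\<lambda>t. q t * t ^ (n - 1))"
    using mono[of "r + s"] r s int2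
    by (subst Henstock_Kurzweil_Integration.integral_diff) (auto simp: integral_unique has_integral_integrable)
  finally show "real n * integral {0..r + s} (\<lambda>t. (1 - q t) * t ^ (n - 1)) =
      (r + s) ^ n - \<bar>r - s\<bar> ^ n * exp (- lam * unit_ball_volume TYPE('b) * min r s ^ n)
      - real n * integral {\<bar>r - s\<bar>..r + s} (\<lambda>t. q t * t ^ (n - 1))"
    using n by (simp only: right_diff_distrib split distrib_left inner) simp
qed

subsection \<open>The contact distance of the Matern cluster process\<close>

text \<open>A nonempty closed set has a point nearest to the origin, so the infimum is attained and
  \<open>\<le>\<close> is matched by the closed ball.\<close>

lemma contact_dist_le_iff:
  assumes "closed (Phi \<omega>)" "Phi \<omega> \<noteq> {}"
  shows "contact_dist Phi \<omega> \<le> r \<longleftrightarrow> Phi \<omega> \<inter> cball 0 r \<noteq> {}"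
proof -
  obtain z where z: "z \<in> Phi \<omega>" "\<And>y. y \<in> Phi \<omega> \<Longrightarrow> dist 0 z \<le> dist 0 y"
    using distance_attains_inf[OF assms, of 0] by blast
  then have "contact_dist Phi \<omega> = norm z"
    unfolding contact_dist_def by (intro cInf_eq_minimum) auto
  moreover have "Phi \<omega> \<inter> cball 0 r \<noteq> {} \<longleftrightarrow> (\<exists>y\<in>Phi \<omega>. norm y \<le> r)"
    by auto
  ultimately show ?thesis
    using z by (auto intro: order_trans)
qed

lemma poisson_pp_void_probability:
  assumes "poisson_pp M Psi lam W" "B \<in> sets borel" "bounded B"
  shows "measure M {\<omega> \<in> space M. Psi \<omega> \<inter> B = {}} = exp (- (lam * measure lborel (B \<inter> W)))"
proof -
  \<comment> \<open>Local finiteness excludes the infinite sets, on which \<open>card\<close> is 0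
    by convention.\<close>
  have "{\<omega> \<in> space M. Psi \<omega> \<inter> B = {}} = {\<omega> \<in> space M. card (Psi \<omega> \<inter> B) = 0}"
    using assms by (auto simp: poisson_pp_def card_eq_0_iff)
  then show ?thesis
    using assms by (simp add: poisson_pp_def)
qed

section \<open>Realizations of the cluster process and its vacancy probability\<close>

locale matern_cluster_process =
  fixes M :: "'a measure"
    and X :: "nat \<Rightarrow> 'a \<Rightarrow> real ^ 'n"
    and D :: "nat \<Rightarrow> 'a \<Rightarrow> (real ^ 'n) set"
    and Phi :: "'a \<Rightarrow> (real ^ 'n) set"
    and lam_p lam_d r_d :: real
  assumes lam_p: "lam_p > 0" and lam_d: "lam_d > 0" and r_d: "r_d > 0"
    and matern: "matern_cluster M lam_p lam_d r_d X D Phi"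
begin

sublocale prob_space M
  using matern by (simp add: matern_cluster_def)

lemma parents_inj: "\<omega> \<in> space M \<Longrightarrow> inj (\<lambda>i. X i \<omega>)"
  and parents_measurable: "random_variable borel (X i)"
  and parents_poisson: "poisson_pp M (\<lambda>\<omega>. range (\<lambda>i. X i \<omega>)) lam_p UNIV"
  and daughters_poisson: "poisson_pp M (D i) lam_d (ball 0 r_d)"
  and daughters_indep: "indep_vars (\<lambda>_. pp_space) D UNIV"
  and Phi_eq: "\<omega> \<in> space M \<Longrightarrow> Phi \<omega> = (\<Union>i. (+) (X i \<omega>) ` D i \<omega>)"
  using matern by (auto simp: matern_cluster_def)

lemma daughters_measurable: "D i \<in> M \<rightarrow>\<^sub>M pp_space"
  using daughters_indep by (auto simp: indep_vars_def)

lemma daughters_subset: "\<omega> \<in> space M \<Longrightarrow> D i \<omega> \<subseteq> ball 0 r_d"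
  and daughters_locally_finite: "\<omega> \<in> space M \<Longrightarrow> bounded B \<Longrightarrow> finite (D i \<omega> \<inter> B)"
  using daughters_poisson[of i] by (auto simp: poisson_pp_def)

text \<open>Injectivity of the enumeration carries finiteness over from the parent points to their
  indices.\<close>

lemma finite_parents_in_bounded:
  assumes "\<omega> \<in> space M" "bounded B"
  shows "finite {i. X i \<omega> \<in> B}"
proof -
  have "finite (range (\<lambda>i. X i \<omega>) \<inter> B)"
    using parents_poisson assms by (simp add: poisson_pp_def)
  then have "finite ((\<lambda>i. X i \<omega>) -` (range (\<lambda>i. X i \<omega>) \<inter> B))"
    using parents_inj[OF assms(1)] by (intro finite_vimageI)
  moreover have "(\<lambda>i. X i \<omega>) -` (range (\<lambda>i. X i \<omega>) \<inter> B) = {i. X i \<omega> \<in> B}"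
    by auto
  ultimately show ?thesis by simp
qed

text \<open>Daughters lie within \<open>r_d\<close> of their parent, so only the finitely many
  parents of norm at most \<open>b + r_d\<close> can reach a set of norm bound \<open>b\<close>,
  each with finitely many points.\<close>

lemma Phi_closed:
  assumes "\<omega> \<in> space M"
  shows "closed (Phi \<omega>)"
proof (rule locally_finite_imp_closed)
  fix B :: "(real ^ 'n) set" assume "bounded B"
  then obtain b where b: "\<And>z. z \<in> B \<Longrightarrow> norm z \<le> b"
    by (auto simp: bounded_iff)
  let ?J = "{i. X i \<omega> \<in> cball 0 (b + r_d)}"
  have "Phi \<omega> \<inter> B \<subseteq> (\<Union>i\<in>?J. (+) (X i \<omega>) ` (D i \<omega> \<inter> ball 0 r_d))"
  proof
    fix z assume z: "z \<in> Phi \<omega> \<inter> B"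
    then obtain i y where iy: "z = X i \<omega> + y" "y \<in> D i \<omega>"
      using Phi_eq[OF assms] by auto
    then have "y \<in> ball 0 r_d" using daughters_subset[OF assms] by blast
    moreover have "norm (X i \<omega>) \<le> norm z + norm y"
      using norm_triangle_ineq4[of z y] iy by simp
    ultimately have "i \<in> ?J" "y \<in> D i \<omega> \<inter> ball 0 r_d"
      using iy b[of z] z by auto
    then show "z \<in> (\<Union>i\<in>?J. (+) (X i \<omega>) ` (D i \<omega> \<inter> ball 0 r_d))"
      unfolding iy(1) by blast
  qed
  moreover have "finite (\<Union>i\<in>?J. (+) (X i \<omega>) ` (D i \<omega> \<inter> ball 0 r_d))"
    using assms by (intro finite_UN_I finite_imageI finite_parents_in_bounded daughters_locally_finite) auto
  ultimately show "finite (Phi \<omega> \<inter> B)"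
    by (rule finite_subset)
qed

lemma Phi_vacant_iff:
  assumes "\<omega> \<in> space M"
  shows "Phi \<omega> \<inter> cball 0 r = {} \<longleftrightarrow> (\<forall>i. D i \<omega> \<inter> cball (- X i \<omega>) r = {})"
proof -
  have "dist (- X i \<omega>) y = norm (X i \<omega> + y)" for i y
    using norm_minus_cancel[of "X i \<omega> + y"] by (simp add: dist_norm del: norm_minus_cancel)
  then have "X i \<omega> + y \<in> cball 0 r \<longleftrightarrow> y \<in> cball (- X i \<omega>) r" for i y
    by simp
  then show ?thesis
    unfolding Phi_eq[OF assms] by blast
qed

text \<open>\<open>Phi\<close> is empty only if all daughter processes are. Each is empty with the
  same probability \<open>q < 1\<close>, so by independence the first \<open>m + 1\<close> are all
  empty with probability \<open>q ^ Suc m\<close>, which tends to 0.\<close>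

lemma AE_Phi_nonempty:
  shows "{\<omega> \<in> space M. Phi \<omega> = {}} \<in> events" "AE \<omega> in M. Phi \<omega> \<noteq> {}"
proof -
  define A where "A = {S. S \<inter> ball (0 :: real ^ 'n) r_d = {}}"
  have A: "A \<in> sets pp_space"
    unfolding A_def by (intro vacancy_in_sets_pp_space) auto
  have sets: "D i -` A \<inter> space M \<in> events" for i
    using daughters_measurable A by (rule measurable_sets)
  have empty: "Phi \<omega> = {} \<longleftrightarrow> (\<forall>i. D i \<omega> \<in> A)" if "\<omega> \<in> space M" for \<omega>
    using Phi_eq[OF that] daughters_subset[OF that] by (fastforce simp: A_def)
  have N: "{\<omega> \<in> space M. Phi \<omega> = {}} = (\<Inter>i. D i -` A \<inter> space M)"
    using empty by auto
  show N_sets: "{\<omega> \<in> space M. Phi \<omega> = {}} \<in> events"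
    unfolding N by (rule sets.countable_INT) (use sets in auto)
  define q where "q = exp (- (lam_d * measure lborel (ball (0 :: real ^ 'n) r_d)))"
  have q: "0 \<le> q" "q < 1"
    using lam_d content_ball_pos[OF r_d, of "0 :: real ^ 'n"] by (auto simp: q_def)
  have one: "prob (D i -` A \<inter> space M) = q" for i
  proof -
    have "D i -` A \<inter> space M = {\<omega> \<in> space M. D i \<omega> \<inter> ball 0 r_d = {}}"
      by (auto simp: A_def)
    then show ?thesis
      using poisson_pp_void_probability[OF daughters_poisson[of i], of "ball 0 r_d"]
      by (simp add: q_def)
  qed
  have "prob {\<omega> \<in> space M. Phi \<omega> = {}} \<le> q ^ Suc m" for m
  proof -
    have "prob {\<omega> \<in> space M. Phi \<omega> = {}} \<le> prob (\<Inter>i\<in>{..m}. D i -` A \<inter> space M)"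
      unfolding N by (intro finite_measure_mono sets.finite_INT) (use sets in auto)
    also have "\<dots> = (\<Prod>i\<in>{..m}. prob (D i -` A \<inter> space M))"
      using daughters_indep A by (intro indep_varsD) auto
    finally show ?thesis by (simp add: one)
  qed
  moreover have "(\<lambda>m. q ^ Suc m) \<longlonglongrightarrow> 0"
    using q by (intro LIMSEQ_Suc LIMSEQ_realpow_zero)
  ultimately have "prob {\<omega> \<in> space M. Phi \<omega> = {}} \<le> 0"
    by (intro LIMSEQ_le_const) auto
  then have "prob {\<omega> \<in> space M. Phi \<omega> = {}} = 0"
    by (simp add: measure_le_0_iff)
  then show "AE \<omega> in M. Phi \<omega> \<noteq> {}"
    using N_sets by (subst AE_iff_measurable[OF N_sets]) (auto simp: emeasure_eq_measure)
qed

text \<open>Vacancy is the decreasing limit of the events \<open>E m\<close> that involve only the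
  first \<open>m\<close> clusters. Conditioning on the parents gives \<open>prob (E m)\<close> as
  the expectation of a finite product, which converges to the product over all parents within
  \<open>r + r_d\<close>; the generating functional evaluates its expectation.\<close>

lemma
  assumes r: "r > 0"
  defines "q \<equiv> \<lambda>t. exp (- lam_d * lens_vol TYPE(real ^ 'n) r r_d t)"
  shows vacancy_events: "{\<omega> \<in> space M. Phi \<omega> \<inter> cball 0 r = {}} \<in> events"
    and prob_vacancy: "prob {\<omega> \<in> space M. Phi \<omega> \<inter> cball 0 r = {}} =
      exp (- (lam_p * (LINT x:cball (0 :: real ^ 'n) (r + r_d)|lborel. 1 - q (norm x))))"
proof -
  define E where "E m = {\<omega> \<in> space M. \<forall>i\<in>{..<m}. D i \<omega> \<inter> cball (- X i \<omega>) r = {}}" for m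
  define R where "R = r + r_d"
  obtain V :: "((real ^ 'n) \<times> (real ^ 'n) set) set" where V: "V \<in> sets (borel \<Otimes>\<^sub>M pp_space)"
    and V_iff: "\<And>c S. closed S \<Longrightarrow> (c, S) \<in> V \<longleftrightarrow> S \<inter> cball c r = {}"
    using vacancy_jointly_measurable[of r] r by (metis less_imp_le)
  \<comment> \<open>The reflection turns the parent position \<open>x\<close> into the centre
    \<open>- x\<close> of the ball that its daughters must avoid.\<close>
  define V' where "V' = (\<lambda>p. (- fst p, snd p)) -` V \<inter> space (borel \<Otimes>\<^sub>M pp_space)"
  have V': "V' \<in> sets (borel \<Otimes>\<^sub>M pp_space)"
    unfolding V'_def by (rule measurable_sets[OF _ V]) measurable
  have V'_iff: "(x, D i \<omega>) \<in> V' \<longleftrightarrow> D i \<omega> \<inter> cball (- x) r = {}" if "\<omega> \<in> space M" for x i \<omega>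
    using V_iff[OF locally_finite_imp_closed[OF daughters_locally_finite[OF that]]]
    by (auto simp: V'_def space_pair_measure)
  have E_eq: "E m = {\<omega> \<in> space M. \<forall>i\<in>{..<m}. (X i \<omega>, D i \<omega>) \<in> V'}" for m
    using V'_iff by (auto simp: E_def)
  have E_sets: "E m \<in> events" for m
    unfolding E_eq
  proof (rule sets.sets_Collect_finite_All)
    fix i assume "i \<in> {..<m}"
    have "(\<lambda>\<omega>. (X i \<omega>, D i \<omega>)) \<in> M \<rightarrow>\<^sub>M borel \<Otimes>\<^sub>M pp_space"
      using parents_measurable daughters_measurable by (rule measurable_Pair)
    from measurable_sets[OF this V'] show "{\<omega> \<in> space M. (X i \<omega>, D i \<omega>) \<in> V'} \<in> events"
      by (simp add: vimage_def Int_def conj_commute)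
  qed auto
  have E_Int: "{\<omega> \<in> space M. Phi \<omega> \<inter> cball 0 r = {}} = (\<Inter>m. E m)"
    using Phi_vacant_iff[of _ r] by (auto simp: E_def)
  show "{\<omega> \<in> space M. Phi \<omega> \<inter> cball 0 r = {}} \<in> events"
    unfolding E_Int by (rule sets.countable_INT) (use E_sets in auto)
  have q_meas [measurable]: "q \<in> borel_measurable borel"
    unfolding q_def by measurable
  have q01: "0 \<le> q t" "q t \<le> 1" for t
    using lam_d by (auto simp: q_def lens_vol_nonneg)
  have single: "prob {\<omega>' \<in> space M. (x, D i \<omega>') \<in> V'} = q (norm x)" for x i
  proof -
    have "{\<omega>' \<in> space M. (x, D i \<omega>') \<in> V'} = {\<omega>' \<in> space M. D i \<omega>' \<inter> cball (- x) r = {}}"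
      using V'_iff by auto
    then show ?thesis
      using poisson_pp_void_probability[OF daughters_poisson[of i], of "cball (- x) r"]
      by (simp add: q_def measure_ball_inter_cball_minus)
  qed
  have prob_E: "prob (E m) = expectation (\<lambda>\<omega>. \<Prod>i<m. q (norm (X i \<omega>)))" for m
    unfolding E_eq using matern
    by (subst prob_all_indep_pairs[OF parents_measurable daughters_indep _ V'])
       (auto simp: matern_cluster_def single)
  \<comment> \<open>Parents outside \<open>cball 0 R\<close> have a lens of volume 0 and contribute
    the factor 1, so the products are constant from some \<open>m\<close> on; injectivity turns the
    product over indices into one over points.\<close>
  have lim: "(\<lambda>m. \<Prod>i<m. q (norm (X i \<omega>))) \<longlonglongrightarrow> (\<Prod>x\<in>range (\<lambda>i. X i \<omega>) \<inter> cball 0 R. q (norm x))"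
    if \<omega>: "\<omega> \<in> space M" for \<omega>
  proof (rule tendsto_eventually)
    define J where "J = {i. X i \<omega> \<in> cball 0 R}"
    have J: "finite J"
      unfolding J_def using \<omega> by (intro finite_parents_in_bounded) auto
    then obtain k where k: "J \<subseteq> {..<k}"
      by (metis finite_nat_iff_bounded)
    have "(\<Prod>i<m. q (norm (X i \<omega>))) = (\<Prod>x\<in>range (\<lambda>i. X i \<omega>) \<inter> cball 0 R. q (norm x))" if "m \<ge> k" for m
    proof -
      have "q (norm (X i \<omega>)) = 1" if "i \<notin> J" for i
        using that by (simp add: J_def R_def q_def lens_vol_disjoint)
      then have "(\<Prod>i<m. q (norm (X i \<omega>))) = (\<Prod>i\<in>J. q (norm (X i \<omega>)))"
        using k \<open>m \<ge> k\<close> by (intro prod.mono_neutral_right) auto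
      also have "\<dots> = (\<Prod>x\<in>(\<lambda>i. X i \<omega>) ` J. q (norm x))"
        using parents_inj[OF \<omega>] by (subst prod.reindex) (auto intro: inj_on_subset)
      also have "(\<lambda>i. X i \<omega>) ` J = range (\<lambda>i. X i \<omega>) \<inter> cball 0 R"
        by (auto simp: J_def)
      finally show ?thesis .
    qed
    then show "\<forall>\<^sub>F m in sequentially. (\<Prod>i<m. q (norm (X i \<omega>))) = (\<Prod>x\<in>range (\<lambda>i. X i \<omega>) \<inter> cball 0 R. q (norm x))"
      by (auto simp: eventually_sequentially)
  qed
  have q_norm: "(\<lambda>x :: real ^ 'n. q (norm x)) \<in> borel_measurable borel"
    by measurable
  note pgfl = poisson_pp_generating_functional[OF parents_poisson less_imp_le[OF lam_p] q_norm
      q01(1) q01(2) borel_closed[OF closed_cball] bounded_cball]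
  have "(\<lambda>m. prob (E m)) \<longlonglongrightarrow> expectation (\<lambda>\<omega>. \<Prod>x\<in>range (\<lambda>i. X i \<omega>) \<inter> cball 0 R. q (norm x))"
    unfolding prob_E
  proof (rule integral_dominated_convergence[where w="\<lambda>_. 1"])
    show "(\<lambda>\<omega>. \<Prod>i<m. q (norm (X i \<omega>))) \<in> borel_measurable M" for m
      using measurable_compose[OF parents_measurable q_norm] by measurable
    show "AE \<omega> in M. norm (\<Prod>i<m. q (norm (X i \<omega>))) \<le> 1" for m
      using q01 by (intro AE_I2) (auto simp: abs_prod intro!: prod_le_1)
  qed (use pgfl(1) lim in auto)
  \<comment> \<open>Continuity of the measure from above; the probability of vacancy then follows by
    uniqueness of limits.\<close>
  moreover have "(\<lambda>m. prob (E m)) \<longlonglongrightarrow> prob (\<Inter>m. E m)"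
    using E_sets by (intro finite_Lim_measure_decseq) (auto simp: decseq_def E_def)
  ultimately show "prob {\<omega> \<in> space M. Phi \<omega> \<inter> cball 0 r = {}} =
      exp (- (lam_p * (LINT x:cball (0 :: real ^ 'n) (r + r_d)|lborel. 1 - q (norm x))))"
    unfolding E_Int pgfl(2) R_def by (metis LIMSEQ_unique)
qed

lemma prob_contact_dist_le:
  assumes r: "r > 0"
  shows "prob {\<omega> \<in> space M. contact_dist Phi \<omega> \<le> r} =
    1 - prob {\<omega> \<in> space M. Phi \<omega> \<inter> cball 0 r = {}}"
proof -
  let ?V = "{\<omega> \<in> space M. Phi \<omega> \<inter> cball 0 r = {}}"
  let ?N = "{\<omega> \<in> space M. Phi \<omega> = {}}"
  let ?C = "{\<omega> \<in> space M. contact_dist Phi \<omega> \<le> r}"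
  have nonempty: "contact_dist Phi \<omega> \<le> r \<longleftrightarrow> Phi \<omega> \<inter> cball 0 r \<noteq> {}" if "\<omega> \<in> space M" "Phi \<omega> \<noteq> {}" for \<omega>
    using Phi_closed[OF that(1)] that(2) by (rule contact_dist_le_iff)
  \<comment> \<open>On the null event that \<open>Phi\<close> is empty the contact distance is the unspecified real \<open>Inf {}\<close>.\<close>
  have "contact_dist Phi \<omega> \<le> r \<longleftrightarrow> (if Phi \<omega> = {} then Inf ({} :: real set) \<le> r else Phi \<omega> \<inter> cball 0 r \<noteq> {})"
    if "\<omega> \<in> space M" for \<omega>
    using nonempty[OF that] by (cases "Phi \<omega> = {}") (simp_all add: contact_dist_def)
  \<comment> \<open>Whichever value \<open>Inf {}\<close> has, \<open>?C\<close> is built from two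
    known events, so it is measurable without completing \<open>M\<close>.\<close>
  then have "?C = (if Inf ({} :: real set) \<le> r then (space M - ?V) \<union> ?N else space M - ?V)"
    by (auto simp: disjoint_iff split: if_splits)
  then have "?C \<in> events"
    using vacancy_events[OF r] AE_Phi_nonempty(1) by auto
  moreover have "AE \<omega> in M. \<omega> \<in> ?C \<longleftrightarrow> \<omega> \<in> space M - ?V"
    using AE_Phi_nonempty(2) AE_space by eventually_elim (use nonempty in auto)
  ultimately have "prob ?C = prob (space M - ?V)"
    using vacancy_events[OF r] by (intro finite_measure_eq_AE) auto
  then show ?thesis
    using prob_compl[OF vacancy_events[OF r]] by simp
qed

end

theorem theorem1:
  fixes M :: "'a measure"
    and X :: "nat \<Rightarrow> 'a \<Rightarrow> real ^ 'n"
    and D :: "nat \<Rightarrow> 'a \<Rightarrow> (real ^ 'n) set"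
    and Phi :: "'a \<Rightarrow> (real ^ 'n) set"
    and lam_p lam_d r_d r :: real
  assumes "lam_p > 0" and "lam_d > 0" and "r_d > 0"
    and "matern_cluster M lam_p lam_d r_d X D Phi"
    and "r > 0"
  defines "n \<equiv> CARD('n)"
    and "v \<equiv> unit_ball_volume TYPE(real ^ 'n)"
    and "A \<equiv> lens_vol TYPE(real ^ 'n)"
    and "F \<equiv> measure M {\<omega> \<in> space M. contact_dist Phi \<omega> \<le> r}"
  shows "F = 1 - exp (- (v * real n * lam_p *
               integral {0..r + r_d} (\<lambda>x. (1 - exp (- lam_d * A r r_d x)) * x ^ (n - 1))))
       \<and> F = 1 - exp (- (v * lam_p *
               ((r + r_d) ^ n - \<bar>r - r_d\<bar> ^ n * exp (- lam_d * v * (min r r_d) ^ n)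
                - real n * integral {\<bar>r - r_d\<bar>..r + r_d} (\<lambda>x. exp (- lam_d * A r r_d x) * x ^ (n - 1)))))"
proof -
  interpret matern_cluster_process M X D Phi lam_p lam_d r_d
    using assms by unfold_locales
  define q where "q t = exp (- lam_d * A r r_d t)" for t
  define K where "K = integral {0..r + r_d} (\<lambda>t. (1 - q t) * t ^ (n - 1))"
  have n: "n = DIM(real ^ 'n)"
    by (simp add: n_def)
  have "q \<in> borel_measurable borel"
    unfolding q_def A_def by measurable
  then have "(LINT x:cball (0 :: real ^ 'n) (r + r_d)|lborel. 1 - q (norm x)) =
      v * real n * (LINT t:{0..r + r_d}|lborel. (1 - q t) * t ^ (n - 1))"
    using integral_radial[where 'b="real ^ 'n", of "\<lambda>t. 1 - q t" "r + r_d"] assms(3,5)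
    by (simp add: v_def n_def)
  \<comment> \<open>The radial formula yields a Lebesgue integral, whereas the claim is stated with
    the gauge integral; set integrability makes them equal.\<close>
  also have "(LINT t:{0..r + r_d}|lborel. (1 - q t) * t ^ (n - 1)) = K"
    unfolding K_def q_def A_def n
    by (intro set_borel_integral_eq_integral(2) integral_lens_split(1)) (use assms(2,3,5) in auto)
  finally have "F = 1 - exp (- (v * real n * lam_p * K))"
    using prob_contact_dist_le[OF assms(5)] prob_vacancy[OF assms(5)]
    by (simp add: F_def q_def A_def mult_ac)
  moreover have "real n * K =
      (r + r_d) ^ n - \<bar>r - r_d\<bar> ^ n * exp (- lam_d * v * (min r r_d) ^ n)
      - real n * integral {\<bar>r - r_d\<bar>..r + r_d} (\<lambda>t. q t * t ^ (n - 1))"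
    unfolding K_def q_def A_def n v_def
    by (intro integral_lens_split(2)) (use assms(2,3,5) in auto)
  moreover have "v * real n * lam_p * K = v * lam_p * (real n * K)"
    by simp
  ultimately show ?thesis
    by (simp only: K_def q_def)
qed

end
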